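(* Independent sets can be taught in $O(n^2)$ rounds: for every graph $G$ with vertex set $V=\{1,\dots,n\}$ there exist a set $P_G$ of positive examples and a set $N_G$ of negative examples for the independent set concept with $|P_G|+|N_G|=O(n^2)$, such that every graph $H$ on $V$ consistent with these examples has exactly the same independent sets as $G$.
   Context: An independent set of $G$ is a set of vertices no two of which are adjacent. Teaching model: for a vertex set concept $\Phi$ and a graph $G$ on $V$, a positive example is a set $V'\subseteq V$ with $\Phi(G,V')$ true, and a negative example is a set $V'\subseteq V$ with $\Phi(G,V')$ false. A graph $H$ on $V$ is consistent with example sets $P,N$ if $\Phi(H,V')$ holds for every $V'\in P$ and fails for every $V'\in N$. The concept can be taught in $g(n)$ rounds if, for every graph $G$ of order $n$, there exist $P_G,N_G$ with $|P_G|+|N_G|\le g(n)$ such that every graph $H$ on $V$ consistent with $P_G,N_G$ is $\Phi$-equivalent to $G$, i.e. $\{V':\Phi(H,V')\}=\{V':\Phi(G,V')\}$. *)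

theory Defs
  imports "Graph_Theory.Pair_Digraph" "HOL-Library.Landau_Symbols"
begin

text \<open>
  A graph on \<open>V\<close> is a \<^locale>\<open>pair_graph\<close> (finite, loopless, symmetric arc relation)
  with vertex set \<open>V\<close>.
\<close>

definition graph_on :: "'a set \<Rightarrow> 'a pair_pre_digraph \<Rightarrow> bool" where
  "graph_on V G \<longleftrightarrow> pair_graph G \<and> pverts G = V"

definition independent_set :: "'a pair_pre_digraph \<Rightarrow> 'a set \<Rightarrow> bool" where
  "independent_set G S \<longleftrightarrow> S \<subseteq> pverts G \<and> (\<forall>u\<in>S. \<forall>v\<in>S. (u, v) \<notin> parcs G)"

type_synonym 'a vertex_set_concept = "'a pair_pre_digraph \<Rightarrow> 'a set \<Rightarrow> bool"

definition positive_examples :: "'a vertex_set_concept \<Rightarrow> 'a pair_pre_digraph \<Rightarrow> 'a set set" where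
  "positive_examples \<Phi> G = {S. S \<subseteq> pverts G \<and> \<Phi> G S}"

definition negative_examples :: "'a vertex_set_concept \<Rightarrow> 'a pair_pre_digraph \<Rightarrow> 'a set set" where
  "negative_examples \<Phi> G = {S. S \<subseteq> pverts G \<and> \<not> \<Phi> G S}"

definition consistent ::
  "'a vertex_set_concept \<Rightarrow> 'a pair_pre_digraph \<Rightarrow> 'a set set \<Rightarrow> 'a set set \<Rightarrow> bool" where
  "consistent \<Phi> H P N \<longleftrightarrow> (\<forall>S\<in>P. \<Phi> H S) \<and> (\<forall>S\<in>N. \<not> \<Phi> H S)"

definition concept_equivalent ::
  "'a vertex_set_concept \<Rightarrow> 'a pair_pre_digraph \<Rightarrow> 'a pair_pre_digraph \<Rightarrow> bool" where
  "concept_equivalent \<Phi> H G \<longleftrightarrow> positive_examples \<Phi> H = positive_examples \<Phi> G"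

text \<open>
  The example sets are subsets of the power set of \<open>{1..n}\<close>, so they are finite and
  \<^const>\<open>card\<close> is their true cardinality.
\<close>

definition can_be_taught :: "nat vertex_set_concept \<Rightarrow> (nat \<Rightarrow> nat) \<Rightarrow> bool" where
  "can_be_taught \<Phi> g \<longleftrightarrow>
     (\<forall>n G. graph_on {1..n} G \<longrightarrow>
        (\<exists>P N. P \<subseteq> positive_examples \<Phi> G \<and> N \<subseteq> negative_examples \<Phi> G \<and>
               card P + card N \<le> g n \<and>
               (\<forall>H. graph_on {1..n} H \<and> consistent \<Phi> H P N \<longrightarrow> concept_equivalent \<Phi> H G)))"

end

theory Submission
  imports Defs
begin

text \<open>Independence is a condition on pairs: a set of vertices is independent exactly when all
  its subsets \<open>{u, v}\<close> are (\<open>independent_set_iff_pairs\<close>). The independent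
  sets of a graph are therefore determined by its verdicts on the sets \<open>{u, v}\<close>, so two
  graphs on the same vertices that agree on these are equivalent
  (\<open>concept_equivalent_if_pairs_agree\<close>). The teacher presents every
  \<open>{u, v}\<close>, as a positive or negative example according to \<open>G\<close>; by
  \<open>card_pairs_le\<close> there are at most n^2 of them.\<close>

lemma independent_set_iff_pairs:
  "independent_set G S \<longleftrightarrow>
     S \<subseteq> pverts G \<and> (\<forall>u\<in>S. \<forall>v\<in>S. independent_set G {u, v})"
  unfolding independent_set_def by blast

lemma finite_pairs:
  assumes "finite V"
  shows "finite {{u, v} |u v. u \<in> V \<and> v \<in> V}"
  using assms by (simp add: finite_image_set2)

text \<open>Ordered pairs map onto the sets \<open>{u, v}\<close>, so counting
  \<open>V \<times> V\<close> bounds their number; this crude count already has the required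
  quadratic order.\<close>

lemma card_pairs_le:
  assumes "finite V"
  shows "card {{u, v} |u v. u \<in> V \<and> v \<in> V} \<le> card V ^ 2"
proof -
  have "{{u, v} |u v. u \<in> V \<and> v \<in> V} = (\<lambda>(u, v). {u, v}) ` (V \<times> V)"
    by auto
  then show ?thesis
    using card_image_le[of "V \<times> V" "\<lambda>(u, v). {u, v}"] assms
    by (simp add: card_cartesian_product power2_eq_square)
qed

lemma concept_equivalent_if_pairs_agree:
  assumes "pverts H = pverts G"
    and "\<And>u v. u \<in> pverts G \<Longrightarrow> v \<in> pverts G \<Longrightarrow>
           independent_set H {u, v} \<longleftrightarrow> independent_set G {u, v}"
  shows "concept_equivalent independent_set H G"
proof -
  have "independent_set H S \<longleftrightarrow> independent_set G S" if "S \<subseteq> pverts G" for S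
    using that assms independent_set_iff_pairs[of H S] independent_set_iff_pairs[of G S]
    by (metis subsetD)
  then show ?thesis
    using assms(1) by (auto simp: concept_equivalent_def positive_examples_def)
qed

lemma independent_set_taught_square: "can_be_taught independent_set (\<lambda>n. n ^ 2)"
  unfolding can_be_taught_def
proof (intro allI impI)
  fix n :: nat and G :: "nat pair_pre_digraph"
  assume "graph_on {1..n} G"
  then have VG: "pverts G = {1..n}"
    by (simp add: graph_on_def)
  \<comment> \<open>The case \<open>u = v\<close> is kept, so \<open>E\<close> also contains the
    singletons; this matches the quantifiers in \<open>independent_set_iff_pairs\<close>, where
    \<open>u\<close> and \<open>v\<close> may coincide.\<close>
  define E where "E = {{u, v} |u v. u \<in> {1..n} \<and> v \<in> {1..n}}"
  define P where "P = E \<inter> positive_examples independent_set G"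
  define N where "N = E \<inter> negative_examples independent_set G"
  have "finite E"
    unfolding E_def by (rule finite_pairs) simp
  moreover have "P \<inter> N = {}"
    by (auto simp: P_def N_def positive_examples_def negative_examples_def)
  \<comment> \<open>Each member of \<open>E\<close> is used once, as a positive or as a negative
    example, so the total number of examples is at most \<open>card E\<close>.\<close>
  ultimately have "card P + card N = card (P \<union> N)"
    by (simp add: P_def N_def card_Un_disjoint)
  also have "\<dots> \<le> card E"
    using \<open>finite E\<close> by (intro card_mono) (auto simp: P_def N_def)
  also have "\<dots> \<le> n ^ 2"
    using card_pairs_le[of "{1..n}"] by (simp add: E_def)
  finally have "card P + card N \<le> n ^ 2" .
  moreover have "concept_equivalent independent_set H G"
    if "graph_on {1..n} H" "consistent independent_set H P N" for H
  proof (rule concept_equivalent_if_pairs_agree)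
    show "pverts H = pverts G"
      using that(1) VG by (simp add: graph_on_def)
    fix u v
    assume uv: "u \<in> pverts G" "v \<in> pverts G"
    then have "{u, v} \<in> E"
      unfolding E_def VG by blast
    \<comment> \<open>The verdict of \<open>G\<close> decides which example set contains
      \<open>{u, v}\<close>; in either case consistency forces \<open>H\<close> to give the same
      verdict.\<close>
    with uv have "{u, v} \<in> (if independent_set G {u, v} then P else N)"
      by (simp add: P_def N_def positive_examples_def negative_examples_def)
    with that(2) show "independent_set H {u, v} \<longleftrightarrow> independent_set G {u, v}"
      by (auto simp: consistent_def split: if_splits)
  qed
  ultimately show "\<exists>P N. P \<subseteq> positive_examples independent_set G \<and>
      N \<subseteq> negative_examples independent_set G \<and> card P + card N \<le> n ^ 2 \<and>
      (\<forall>H. graph_on {1..n} H \<and> consistent independent_set H P N \<longrightarrow>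
           concept_equivalent independent_set H G)"
    by (intro exI[of _ P] exI[of _ N]) (auto simp: P_def N_def)
qed

theorem theorem3p2:
  shows "\<exists>g :: nat \<Rightarrow> nat.
           (\<lambda>n. real (g n)) \<in> O(\<lambda>n. real n ^ 2) \<and> can_be_taught independent_set g"
  using independent_set_taught_square by (intro exI[of _ "\<lambda>n. n ^ 2"]) simp

end
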